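(* Let $p$ be an odd prime, $n$ a positive integer and $G=PGL(2,p^n)$. Then the number of connected components of $\mathcal{P}^*(G)$ is equal to $(p^{2n+1}-1)/(p-1)$.
   Context: For a finite group $G$, the proper power graph $\mathcal{P}^*(G)$ is the simple graph with vertex set $G\setminus\{1\}$ in which two distinct vertices are adjacent if and only if one is a power of the other. *)

theory Defs
  imports
    "HOL-Analysis.Determinants"
    "HOL-Algebra.Coset"
    "HOL-Computational_Algebra.Primes"
    "Graph_Theory.Digraph_Component"
begin

definition GL :: "('a::field ^ 'n ^ 'n) monoid" where
  "GL = \<lparr>carrier = {A. invertible A}, mult = (**), one = mat 1\<rparr>"

definition scalar_matrices :: "('a::field ^ 'n ^ 'n) set" where
  "scalar_matrices = {mat c | c. c \<noteq> 0}"

definition PGL :: "('a::field ^ 'n ^ 'n) set monoid" where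
  "PGL = GL Mod scalar_matrices"

text \<open>Undirected simple graphs are represented, as usual in \<open>Graph_Theory\<close>, by loop-free symmetric
  digraphs. For finite groups, integer and natural number exponents give the same graph.\<close>

definition proper_power_graph :: "('a, 'b) monoid_scheme \<Rightarrow> 'a pair_pre_digraph" where
  "proper_power_graph G =
     \<lparr>pverts = carrier G - {\<one>\<^bsub>G\<^esub>},
      parcs = {(x, y). x \<in> carrier G - {\<one>\<^bsub>G\<^esub>} \<and> y \<in> carrier G - {\<one>\<^bsub>G\<^esub>} \<and> x \<noteq> y \<and>
        ((\<exists>k::int. y = x [^]\<^bsub>G\<^esub> k) \<or> (\<exists>k::int. x = y [^]\<^bsub>G\<^esub> k))}\<rparr>"

text \<open>The qualified name avoids the topological constant \<open>connected\<close>. Connected graphs are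
  nonempty in \<open>Graph_Theory\<close>, so the empty graph has no components.\<close>

definition connected_components :: "('a, 'b) pre_digraph \<Rightarrow> ('a, 'b) pre_digraph set" where
  "connected_components \<Gamma> = {H. pre_digraph.max_subgraph \<Gamma> Digraph_Component.connected H}"

end

(* Every nontrivial class in PGL(2,q) is represented by t + B with B a nonzero traceless matrix, and
   B^2 is a scalar d. Commuting is an equivalence relation on nonscalar 2x2 matrices, so the
   centralizer of a representative is constant on the components of the proper power graph.
   If d is nonzero, the class of B is the only involution with this centralizer. It lies in the
   component of x = [t + B]: it is a power of x when x has even order, and otherwise x and [B] are
   both powers of x[B]. Hence these components correspond to the involutions, that is, to the
   invertible traceless matrices up to scalars, of which there are (q^3 - q^2)/(q - 1) = q^2.
   If d = 0, the class is [1 + M] for a unique nonzero nilpotent M; it has order p and its component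
   consists of the p - 1 generators of the subgroup it generates. There are q^2 - 1 such M, and
   q^2 + (q^2 - 1)/(p - 1) = (p q^2 - 1)/(p - 1). *)

theory Submission
  imports Defs "HOL-Number_Theory.Residues" "HOL-Algebra.Multiplicative_Group"
begin

section \<open>Components of proper power graphs\<close>

text \<open>Reachability in a symmetric digraph is symmetric, so connectedness and strong
  connectedness agree on induced subgraphs. This makes \<open>sccs\<close> and \<open>scc_of\<close>
  available for counting components.\<close>

lemma connected_components_eq_sccs:
  assumes "sym_digraph \<Gamma>"
  shows "connected_components \<Gamma> = pre_digraph.sccs \<Gamma>"
proof -
  interpret sym_digraph \<Gamma> by fact
  \<comment> \<open>Adding arcs between the same vertices keeps a graph connected, so maximal
    connected subgraphs are induced.\<close>
  have mono: "arc_mono Digraph_Component.connected"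
    unfolding arc_mono_def
    by (metis spanning_def subgraph_def wf_digraph.connected_spanning_imp_connected)
  have sc_con: "Digraph_Component.connected H" if "strongly_connected H" "wf_digraph H" for H :: "('a,'b) pre_digraph"
  proof -
    interpret H: wf_digraph H by fact
    show ?thesis
      using that(1) by (intro H.connectedI) (auto simp: strongly_connected_def intro: H.reachable_mk_symmetricI)
  qed
  have con_sc: "strongly_connected H" if "induced_subgraph H \<Gamma>" "Digraph_Component.connected H" for H
    using that wf_digraph.symmetric_connected_imp_strongly_connected
      induced_graph_imp_symmetric[OF sym_arcs that(1)] wf_digraphI_induced by blast
  have 1: "max_subgraph strongly_connected H" if H: "max_subgraph Digraph_Component.connected H" for H
    unfolding max_subgraph_def
  proof (intro conjI allI impI)
    show "subgraph H \<Gamma>" using H by (simp add: max_subgraph_def)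
    show "strongly_connected H"
      using H con_sc induced_subgraphI_arc_mono[OF H mono] by (simp add: max_subgraph_def)
    show "\<not> (subgraph H' \<Gamma> \<and> strongly_connected H')" if "H' \<noteq> H \<and> subgraph H H'" for H'
      using that H sc_con by (auto simp: max_subgraph_def)
  qed
  have 2: "max_subgraph Digraph_Component.connected H" if H: "max_subgraph strongly_connected H" for H
    unfolding max_subgraph_def
  proof (intro conjI allI impI notI)
    show sub: "subgraph H \<Gamma>" using H by (simp add: max_subgraph_def)
    then show "Digraph_Component.connected H"
      using H sc_con by (auto simp: max_subgraph_def)
    fix H' assume H': "H' \<noteq> H \<and> subgraph H H'" "subgraph H' \<Gamma> \<and> Digraph_Component.connected H'"
    \<comment> \<open>\<open>H'\<close> need not be symmetric, so the subgraph induced on its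
      vertices takes its place; that one is symmetric and hence strongly connected.\<close>
    let ?K = "\<Gamma> \<restriction> verts H'"
    have sH': "subgraph H' ?K" using H' subgraph_induce_subgraphI2 by blast
    have K: "induced_subgraph ?K \<Gamma>" using H' by (intro induced_induce) auto
    have "Digraph_Component.connected ?K"
      using mono[unfolded arc_mono_def, rule_format, of H' ?K] sH' H' by simp
    then have "strongly_connected ?K" using con_sc K by blast
    moreover have "subgraph H ?K" using H' sH' subgraph_trans by blast
    ultimately have "?K = H" using H K by (auto simp: max_subgraph_def induced_imp_subgraph)
    then have "subgraph H' H" using sH' by simp
    then have "H' = H"
      using H' by (intro pre_digraph.equality) (auto simp: subgraph_def compatible_def)
    then show False using H' by simp
  qed
  show ?thesis
    unfolding connected_components_def sccs_altdef2 using 1 2 by auto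
qed

lemma (in group) pair_sym_digraph_proper_power_graph: "pair_sym_digraph (proper_power_graph G)"
  by unfold_locales (auto simp: proper_power_graph_def symmetric_def sym_def)

text \<open>Here \<open>N\<close> consists of the elements of order \<open>p\<close>, and \<open>\<tau>\<close> is an invariant of components that
  separates involutions.\<close>

theorem (in group) card_components_proper_power_graph:
  fixes \<tau> :: "'a \<Rightarrow> 'c"
  defines "D \<equiv> carrier G - {\<one>}"
  assumes fin: "finite (carrier G)" and p: "prime p" "odd p"
    and tau: "\<And>x k. x \<in> carrier G \<Longrightarrow> x [^] (k::int) \<noteq> \<one> \<Longrightarrow> \<tau> (x [^] k) = \<tau> x"
    and N: "N \<subseteq> D" "\<And>x. x \<in> N \<Longrightarrow> x [^] p = \<one>"
      "\<And>x y. x \<in> N \<Longrightarrow> y \<in> D \<Longrightarrow> \<tau> y = \<tau> x \<Longrightarrow> y \<in> N"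
    and ex: "\<And>x. x \<in> D - N \<Longrightarrow> \<exists>b\<in>D. b \<otimes> b = \<one> \<and> \<tau> b = \<tau> x \<and> x \<otimes> b = b \<otimes> x"
    and uniq: "\<And>b b'. b \<in> D \<Longrightarrow> b' \<in> D \<Longrightarrow> b \<otimes> b = \<one> \<Longrightarrow> b' \<otimes> b' = \<one> \<Longrightarrow> \<tau> b = \<tau> b' \<Longrightarrow> b = b'"
  shows "(p - 1) * card (connected_components (with_proj (proper_power_graph G)))
    = card N + (p - 1) * card {b \<in> D. b \<otimes> b = \<one>}"
proof -

  \<comment> \<open>Vertices, reachability and components\<close>
  let ?\<Gamma> = "proper_power_graph G"
  let ?I = "{b \<in> D. b \<otimes> b = \<one>}"
  interpret \<Gamma>: pair_sym_digraph ?\<Gamma> by (rule pair_sym_digraph_proper_power_graph)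
  have verts: "pverts ?\<Gamma> = D" by (simp add: proper_power_graph_def D_def)
  have DG: "x \<in> carrier G" if "x \<in> D" for x using that by (simp add: D_def)
  have finD: "finite D" using fin by (simp add: D_def)
  have tau_reach: "\<tau> x = \<tau> y" if "x \<rightarrow>\<^sup>*\<^bsub>?\<Gamma>\<^esub> y" for x y
    using that unfolding reachable_def
  proof (induction rule: rtrancl_on_induct)
    case (step y z)
    \<comment> \<open>One end of every arc is a nontrivial power of the other, and
      \<open>\<tau>\<close> does not change under such powers.\<close>
    then show ?case using tau by (auto simp: proper_power_graph_def)
  qed simp
  have reach: "x \<rightarrow>\<^sup>*\<^bsub>?\<Gamma>\<^esub> (x [^] k)" if "x \<in> D" "x [^] k \<in> D" for x and k :: nat
  proof (cases "x [^] k = x")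
    case True then show ?thesis using that verts by simp
  next
    case False
    have "x [^] k = x [^] int k" by (simp add: int_pow_int)
    then have "(x, x [^] k) \<in> parcs ?\<Gamma>"
      using that False unfolding proper_power_graph_def D_def by simp metis
    then show ?thesis using \<Gamma>.reachable_adjI by simp
  qed
  have scc: "\<Gamma>.scc_of x = {y. x \<rightarrow>\<^sup>*\<^bsub>?\<Gamma>\<^esub> y}" for x
    unfolding \<Gamma>.scc_of_def by (blast intro: \<Gamma>.symmetric_reachable')
  have scc_D: "\<Gamma>.scc_of x \<subseteq> D" for x
    unfolding scc using \<Gamma>.reachable_in_verts verts by auto
  have comps: "card (connected_components ?\<Gamma>) = card (\<Gamma>.scc_of ` D)"
    using connected_components_eq_sccs[OF \<Gamma>.sym_digraph_axioms] \<Gamma>.card_sccs_verts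
      \<Gamma>.sccs_verts_conv_scc_of verts by simp

  \<comment> \<open>Components that contain an involution\<close>
  have odd_pow: "b [^] m = b" if b: "b \<in> ?I" and m: "odd m" for b and m :: nat
  proof -
    obtain k where "m = 2 * k + 1" using m oddE by blast
    moreover have "b [^] (2 * k) = \<one>"
      using b DG nat_pow_pow[of b 2 k] by (simp add: numeral_2_eq_2)
    ultimately show ?thesis using b DG by simp
  qed
  have invol_reach: "x \<rightarrow>\<^sup>*\<^bsub>?\<Gamma>\<^esub> b"
    if x: "x \<in> D" and b: "b \<in> ?I" "\<tau> b = \<tau> x" and xb: "x \<otimes> b = b \<otimes> x" for x b
  proof -
    have xG: "x \<in> carrier G" "b \<in> carrier G" "x \<noteq> \<one>" "b \<noteq> \<one>" using x b by (auto simp: D_def)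
    have pos: "ord x > 0" using fin ord_ge_1 xG by (simp add: Suc_le_eq)
    show ?thesis
    proof (cases "even (ord x)")
      case True
      \<comment> \<open>The power at half the order is an involution with the invariant of
        \<open>x\<close>, so \<open>uniq\<close> identifies it with \<open>b\<close>.\<close>
      let ?k = "ord x div 2"
      have "\<not> ord x dvd ?k" using pos True by (auto dest!: dvd_imp_le)
      then have ne: "x [^] ?k \<noteq> \<one>" using pow_eq_id xG by blast
      have "x [^] ?k \<otimes> x [^] ?k = x [^] ord x"
        using True xG nat_pow_mult by (metis dvd_mult_div_cancel mult_2)
      then have sq: "x [^] ?k \<otimes> x [^] ?k = \<one>" using xG by simp
      have "\<tau> (x [^] ?k) = \<tau> x" using tau[of x "int ?k"] ne xG by (simp add: int_pow_int)
      moreover have "x [^] ?k \<in> D" using ne xG by (simp add: D_def)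
      ultimately have "x [^] ?k = b" using uniq[of "x [^] ?k" b] b sq by simp
      then show ?thesis using reach[OF x, of ?k] b by simp
    next
      case False
      \<comment> \<open>For odd order, both \<open>x\<close> and \<open>b\<close> are powers of \<open>x \<otimes> b\<close>.\<close>
      let ?y = "x \<otimes> b"
      have y: "?y \<in> carrier G" using xG by simp
      have pw: "?y [^] k = x [^] k \<otimes> b [^] k" for k :: nat
        using pow_mult_distrib xb xG by blast
      have yb: "?y [^] ord x = b" using pw odd_pow[OF b(1) False] xG by simp
      then have "?y \<in> D" using y xG by (auto simp: D_def)
      \<comment> \<open>Since \<open>?y\<close> raised to \<open>ord x\<close> is \<open>b\<close>,
        one more factor \<open>?y\<close> gives \<open>b \<otimes> ?y\<close>, where the two copies
        of \<open>b\<close> cancel.\<close>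
      have yx: "?y [^] (ord x + 1) = x"
      proof -
        have "?y [^] (ord x + 1) = b \<otimes> ?y" using yb y by simp
        also have "\<dots> = b \<otimes> (b \<otimes> x)" using xb by simp
        also have "\<dots> = b \<otimes> b \<otimes> x" using xG m_assoc by simp
        also have "\<dots> = x" using b xG by simp
        finally show ?thesis .
      qed
      have "?y \<rightarrow>\<^sup>*\<^bsub>?\<Gamma>\<^esub> x" using reach[OF \<open>?y \<in> D\<close>, of "ord x + 1"] yx x by simp
      moreover have "?y \<rightarrow>\<^sup>*\<^bsub>?\<Gamma>\<^esub> b" using reach[OF \<open>?y \<in> D\<close>, of "ord x"] yb b by simp
      ultimately show ?thesis
        using \<Gamma>.symmetric_reachable' \<Gamma>.reachable_trans by blast
    qed
  qed
  \<comment> \<open>As \<open>p\<close> is odd, an involution is its own \<open>p\<close>-th power,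
    whereas elements of \<open>N\<close> have trivial \<open>p\<close>-th power.\<close>
  have I_N: "?I \<subseteq> D - N"
    using N(2) odd_pow p(2) by (fastforce simp: D_def)
  have scc_I: "\<Gamma>.scc_of ` (D - N) = \<Gamma>.scc_of ` ?I"
  proof
    show "\<Gamma>.scc_of ` ?I \<subseteq> \<Gamma>.scc_of ` (D - N)" using I_N by blast
    show "\<Gamma>.scc_of ` (D - N) \<subseteq> \<Gamma>.scc_of ` ?I"
    proof
      fix S assume "S \<in> \<Gamma>.scc_of ` (D - N)"
      then obtain x where x: "x \<in> D - N" "S = \<Gamma>.scc_of x" by blast
      then obtain b where b: "b \<in> ?I" "\<tau> b = \<tau> x" "x \<otimes> b = b \<otimes> x" using ex by blast
      then have "b \<in> \<Gamma>.scc_of x" using invol_reach[of x b] x by (simp add: scc)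
      then have "S = \<Gamma>.scc_of b" using \<Gamma>.scc_of_eq x by simp
      then show "S \<in> \<Gamma>.scc_of ` ?I" using b(1) by (rule image_eqI)
    qed
  qed
  \<comment> \<open>\<open>\<tau>\<close> is constant on components and separates
    involutions.\<close>
  have inj_I: "inj_on \<Gamma>.scc_of ?I"
  proof (rule inj_onI)
    fix b b' assume b: "b \<in> ?I" "b' \<in> ?I" and eq: "\<Gamma>.scc_of b = \<Gamma>.scc_of b'"
    have "b' \<in> \<Gamma>.scc_of b" using eq \<Gamma>.in_scc_of_self b verts by simp
    then have "\<tau> b = \<tau> b'" using tau_reach[of b b'] by (simp add: scc)
    then show "b = b'" using uniq b by simp
  qed

  \<comment> \<open>Components of elements of order \<open>p\<close>\<close>
  have scc_N: "\<Gamma>.scc_of x \<subseteq> N" if "x \<in> N" for x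
  proof
    fix y assume y: "y \<in> \<Gamma>.scc_of x"
    then have "\<tau> y = \<tau> x" using tau_reach[of x y] by (simp add: scc)
    moreover have "y \<in> D" using y scc_D[of x] by (rule subsetD[rotated])
    ultimately show "y \<in> N" by (intro N(3)[OF that])
  qed
  have disj: "\<Gamma>.scc_of ` N \<inter> \<Gamma>.scc_of ` (D - N) = {}"
  proof -
    have False if "x \<in> N" "y \<in> D - N" "\<Gamma>.scc_of x = \<Gamma>.scc_of y" for x y
      using that scc_N[OF that(1)] \<Gamma>.in_scc_of_self[of y] verts by auto
    then show ?thesis by blast
  qed
  have NG: "x \<in> carrier G" "x \<noteq> \<one>" if "x \<in> N" for x using that N(1) by (auto simp: D_def)
  have ordp: "ord x = p" if "x \<in> N" for x
    using N(2)[OF that] NG[OF that] p(1) pow_eq_id ord_eq_1 by (metis prime_nat_iff)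
  have card_gen: "card (generate G {x}) = p" if "x \<in> N" for x
    using generate_pow_card NG(1)[OF that] ordp[OF that] by simp
  \<comment> \<open>Both subgroups have order \<open>p\<close>, so the inclusion of one in the other
    is an equality.\<close>
  have gen_pow: "generate G {x [^] k} = generate G {x}" if "x \<in> N" "x [^] k \<in> N" for x and k :: int
  proof (rule card_subset_eq)
    show "finite (generate G {x})"
      using card_gen[OF that(1)] p(1) card_ge_0_finite prime_gt_0_nat by metis
    have "x [^] k \<in> generate G {x}" using generate_pow[OF NG(1)[OF that(1)]] by blast
    then show "generate G {x [^] k} \<subseteq> generate G {x}"
      using generate_subgroup_incl[of "{x [^] k}"] generate_is_subgroup[of "{x}"] NG(1)[OF that(1)]
      by simp
    show "card (generate G {x [^] k}) = card (generate G {x})"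
      using card_gen that by simp
  qed
  have card_scc_N: "card (\<Gamma>.scc_of x) = p - 1" if x: "x \<in> N" for x
  proof -
    \<comment> \<open>A path that starts in \<open>N\<close> stays in \<open>N\<close>, and there
      every arc preserves the generated subgroup. Hence the component of \<open>x\<close> lies in
      that subgroup; conversely every nontrivial element of it is a power of
      \<open>x\<close>.\<close>
    have gen: "generate G {y} = generate G {x}" if "x \<rightarrow>\<^sup>*\<^bsub>?\<Gamma>\<^esub> y" for y
      using that unfolding reachable_def
    proof (induction rule: rtrancl_on_induct)
      case (step y z)
      have "(y, z) \<in> parcs ?\<Gamma>" "y \<in> \<Gamma>.scc_of x"
        using step by (auto simp: scc reachable_def)
      then have "z \<in> \<Gamma>.scc_of x"
        using \<Gamma>.reachable_adj_trans[of x y z] by (simp add: scc)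
      then have "y \<in> N" "z \<in> N" using scc_N[OF x] \<open>y \<in> \<Gamma>.scc_of x\<close> by auto
      moreover have "(\<exists>k::int. z = y [^] k) \<or> (\<exists>k::int. y = z [^] k)"
        using step by (auto simp: proper_power_graph_def)
      ultimately show ?case using gen_pow step.IH by metis
    qed simp
    have "\<Gamma>.scc_of x \<subseteq> generate G {x} - {\<one>}"
    proof
      fix y assume y: "y \<in> \<Gamma>.scc_of x"
      then have "y \<in> generate G {x}"
        using gen[of y] generate.incl[of y "{y}" G] by (simp add: scc)
      moreover have "y \<in> D" using y scc_D[of x] by (rule subsetD[rotated])
      ultimately show "y \<in> generate G {x} - {\<one>}" by (simp add: D_def)
    qed
    moreover have "generate G {x} - {\<one>} \<subseteq> \<Gamma>.scc_of x"
    proof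
      fix y assume y: "y \<in> generate G {x} - {\<one>}"
      then obtain k :: nat where "y = x [^] k"
        using generate_pow_nat[OF NG(1)[OF x]] ordp[OF x] p(1) prime_gt_0_nat by auto
      then show "y \<in> \<Gamma>.scc_of x"
        using y reach[of x k] NG[OF x] by (auto simp: scc D_def)
    qed
    ultimately have "\<Gamma>.scc_of x = generate G {x} - {\<one>}" by blast
    then show ?thesis using card_gen[OF x] by (simp add: generate.one)
  qed
  \<comment> \<open>\<open>N\<close> is a disjoint union of components with \<open>p - 1\<close>
    elements each; the multiplied form avoids a division of natural numbers.\<close>
  have "(p - 1) * card (\<Gamma>.scc_of ` N) = card (\<Union>(\<Gamma>.scc_of ` N))"
  proof (rule card_partition)
    show "finite (\<Gamma>.scc_of ` N)" using finD N(1) finite_subset by blast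
    show "finite (\<Union> (\<Gamma>.scc_of ` N))" using finD scc_D by (meson UN_least finite_subset)
    show "card c = p - 1" if "c \<in> \<Gamma>.scc_of ` N" for c using that card_scc_N by blast
    show "c1 \<inter> c2 = {}" if "c1 \<in> \<Gamma>.scc_of ` N" "c2 \<in> \<Gamma>.scc_of ` N" "c1 \<noteq> c2" for c1 c2
    proof (rule ccontr)
      assume "c1 \<inter> c2 \<noteq> {}"
      then obtain y where "y \<in> c1" "y \<in> c2" by blast
      then have "c1 = \<Gamma>.scc_of y" "c2 = \<Gamma>.scc_of y" using that \<Gamma>.scc_of_eq[of y] by auto
      then show False using \<open>c1 \<noteq> c2\<close> by simp
    qed
  qed
  also have "\<Union>(\<Gamma>.scc_of ` N) = N"
  proof
    show "\<Union>(\<Gamma>.scc_of ` N) \<subseteq> N" using scc_N by (rule UN_least)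
    show "N \<subseteq> \<Union>(\<Gamma>.scc_of ` N)"
    proof
      fix x assume "x \<in> N"
      then have "x \<in> pverts ?\<Gamma>" using N(1) verts by auto
      then show "x \<in> \<Union>(\<Gamma>.scc_of ` N)" using \<open>x \<in> N\<close> \<Gamma>.in_scc_of_self[of x] by auto
    qed
  qed
  finally have cN: "(p - 1) * card (\<Gamma>.scc_of ` N) = card N" .

  \<comment> \<open>Sum over both kinds of components\<close>
  have "D = N \<union> (D - N)" using N(1) by blast
  then have "card (\<Gamma>.scc_of ` D) = card (\<Gamma>.scc_of ` N \<union> \<Gamma>.scc_of ` (D - N))"
    by (metis image_Un)
  also have "\<dots> = card (\<Gamma>.scc_of ` N) + card (\<Gamma>.scc_of ` (D - N))"
    using disj finD N(1) by (intro card_Un_disjoint) (auto intro: finite_subset)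
  also have "card (\<Gamma>.scc_of ` (D - N)) = card ?I"
    unfolding scc_I using inj_I card_image by blast
  finally show ?thesis
    using comps cN by (simp add: algebra_simps)
qed

section \<open>Commuting 2-by-2 matrices\<close>

text \<open>In odd characteristic every matrix is uniquely the sum of a scalar matrix \<open>t\<close> and a traceless
  matrix \<open>(x, y; z, -x)\<close>, whose square is the scalar \<open>x\<^sup>2 + y z\<close>.\<close>

definition qmat :: "'a::field \<Rightarrow> 'a \<Rightarrow> 'a \<Rightarrow> 'a \<Rightarrow> 'a ^ 2 ^ 2" where
  "qmat t x y z = vector [vector [t + x, y], vector [z, t - x]]"

lemma qmat_nth [simp]:
  "qmat t x y z $ 1 $ 1 = t + x" "qmat t x y z $ 1 $ 2 = y"
  "qmat t x y z $ 2 $ 1 = z" "qmat t x y z $ 2 $ 2 = t - x"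
  by (simp_all add: qmat_def vector_2)

lemma matrix_2_eq_iff:
  "A = B \<longleftrightarrow> A $ 1 $ 1 = B $ 1 $ 1 \<and> A $ 1 $ 2 = B $ 1 $ 2 \<and> A $ 2 $ 1 = B $ 2 $ 1 \<and> A $ 2 $ 2 = B $ 2 $ 2"
  for A B :: "'a ^ 2 ^ 2"
  by (auto simp: vec_eq_iff forall_2)

lemma mat_eq_qmat: "(mat c :: 'a::field ^ 2 ^ 2) = qmat c 0 0 0"
  by (simp add: matrix_2_eq_iff mat_def)

lemma mat_mult_qmat: "mat c ** qmat t x y z = qmat (c * t) (c * x) (c * y) (c * z)"
  by (simp add: matrix_2_eq_iff matrix_matrix_mult_def sum_2 mat_def algebra_simps)

lemma invertible_qmat_iff: "invertible (qmat t x y z) \<longleftrightarrow> t\<^sup>2 \<noteq> x\<^sup>2 + y * z"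
  by (simp add: invertible_det_nz det_2 algebra_simps power2_eq_square)

lemma qmat_mult_self:
  "qmat t x y z ** qmat t x y z
    = qmat (t\<^sup>2 + x\<^sup>2 + y * z) (2 * t * x) (2 * t * y) (2 * t * z)"
  by (simp add: matrix_2_eq_iff matrix_matrix_mult_def sum_2 algebra_simps power2_eq_square)

context
  assumes two: "(2::'a::field) \<noteq> 0"
begin

lemma half_add_half: "a / 2 + a / 2 = (a::'a)"
  using two by (simp add: field_simps)

lemma qmat_eq_iff:
  "qmat t x y z = qmat t' x' y' z' \<longleftrightarrow> t = t' \<and> x = x' \<and> y = y' \<and> z = (z'::'a)"
proof
  assume "qmat t x y z = qmat t' x' y' z'"
  then have h: "t + x = t' + x'" "t - x = t' - x'" "y = y'" "z = z'"
    by (auto simp: matrix_2_eq_iff)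
  have "(t + x) + (t - x) = (t' + x') + (t' - x')" by (simp only: h)
  then have "2 * t = 2 * t'" by (simp add: algebra_simps flip: mult_2)
  then have "t = t'" using two by simp
  then show "t = t' \<and> x = x' \<and> y = y' \<and> z = z'" using h by simp
qed simp

lemma qmat_exhaust:
  fixes A :: "'a ^ 2 ^ 2"
  obtains t x y z where "A = qmat t x y z"
proof
  have *: "a = (a + d) / 2 + (a - d) / 2" "d = (a + d) / 2 - (a - d) / 2" for a d :: 'a
    using two by (simp_all add: add_divide_distrib diff_divide_distrib half_add_half)
  show "A = qmat ((A$1$1 + A$2$2) / 2) ((A$1$1 - A$2$2) / 2) (A$1$2) (A$2$1)"
    using * by (simp add: matrix_2_eq_iff)
qed

lemma mat_eq_qmat_iff: "qmat t x y z = mat c \<longleftrightarrow> t = c \<and> x = 0 \<and> y = 0 \<and> z = (0::'a)"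
  by (simp add: mat_eq_qmat qmat_eq_iff)

text \<open>The scalar parts cancel in the commutator, whose entries are, up to signs and factors 2,
  the 2-by-2 minors of the coordinate vectors \<open>(x, y, z)\<close> and
  \<open>(x', y', z')\<close>. So commuting means that these vectors are parallel.\<close>

lemma qmat_commute_iff:
  "qmat t x y z ** qmat t' x' y' z' = qmat t' x' y' z' ** qmat t x y z
    \<longleftrightarrow> x * y' = x' * y \<and> y * z' = y' * z \<and> x * z' = x' * (z::'a)"
proof -
  have e12: "(t + x) * y' + y * (t' - x') = (t' + x') * y + y' * (t - x) \<longleftrightarrow> x * y' + x * y' = x' * y + x' * y"
    by (rule iffI; Groebner_Basis.algebra)
  have e21: "z * (t' + x') + (t - x) * z' = z' * (t + x) + (t' - x') * z \<longleftrightarrow> x * z' + x * z' = x' * z + x' * z"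
    by (rule iffI; Groebner_Basis.algebra)
  have e11: "(t + x) * (t' + x') + y * z' = (t' + x') * (t + x) + y' * z \<longleftrightarrow> y * z' = y' * z"
    by (rule iffI; Groebner_Basis.algebra)
  have e22: "z * y' + (t - x) * (t' - x') = z' * y + (t' - x') * (t - x) \<longleftrightarrow> y * z' = y' * z"
    by (rule iffI; Groebner_Basis.algebra)
  show ?thesis
    unfolding matrix_2_eq_iff
    using two by (simp add: matrix_matrix_mult_def sum_2 e11 e12 e21 e22) blast
qed

text \<open>Each minor of the two primed vectors vanishes after multiplication by \<open>x\<close>,
  by \<open>y\<close> and by \<open>z\<close>, one of which is nonzero.\<close>

lemma parallel_trans:
  fixes x y z :: 'a
  assumes "x * y' = x' * y" "y * z' = y' * z" "x * z' = x' * z"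
    and "x * y'' = x'' * y" "y * z'' = y'' * z" "x * z'' = x'' * z"
    and "x \<noteq> 0 \<or> y \<noteq> 0 \<or> z \<noteq> 0"
  shows "x' * y'' = x'' * y'" "y' * z'' = y'' * z'" "x' * z'' = x'' * z'"
proof -
  have "x * (x' * y'' - x'' * y') = 0" "y * (x' * y'' - x'' * y') = 0" "z * (x' * y'' - x'' * y') = 0"
    "x * (y' * z'' - y'' * z') = 0" "y * (y' * z'' - y'' * z') = 0" "z * (y' * z'' - y'' * z') = 0"
    "x * (x' * z'' - x'' * z') = 0" "y * (x' * z'' - x'' * z') = 0" "z * (x' * z'' - x'' * z') = 0"
    using assms(1-6) by Groebner_Basis.algebra+
  then show "x' * y'' = x'' * y'" "y' * z'' = y'' * z'" "x' * z'' = x'' * z'"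
    using assms(7) by auto
qed

text \<open>Any nonzero coordinate gives the ratio \<open>c\<close>. The primed vector may be zero,
  so \<open>c\<close> may be zero as well.\<close>

lemma parallelE:
  fixes x y z :: 'a
  assumes "x * y' = x' * y" "y * z' = y' * z" "x * z' = x' * z"
    and "x \<noteq> 0 \<or> y \<noteq> 0 \<or> z \<noteq> 0"
  obtains c where "x' = c * x" "y' = c * y" "z' = c * z"
proof -
  consider "x \<noteq> 0" | "y \<noteq> 0" | "z \<noteq> 0" using assms(4) by blast
  then show ?thesis
  proof cases
    case 1
    then show ?thesis using assms(1-3) by (intro that[of "x' / x"]) (simp_all add: field_simps)
  next
    case 2
    then show ?thesis using assms(1-3) by (intro that[of "y' / y"]) (simp_all add: field_simps)
  next
    case 3
    then show ?thesis using assms(1-3) by (intro that[of "z' / z"]) (simp_all add: field_simps)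
  qed
qed

text \<open>Nonscalar matrices have nonzero coordinate vectors, so commuting, being parallelism of
  these vectors, is transitive through a nonscalar matrix. The two inclusions differ by exchanging
  \<open>A\<close> and \<open>B\<close>.\<close>

lemma centralizer_eq:
  fixes A B :: "'a ^ 2 ^ 2"
  assumes AB: "A ** B = B ** A" and A: "\<And>c. A \<noteq> mat c" and B: "\<And>c. B \<noteq> mat c"
  shows "{C. A ** C = C ** A} = {C. B ** C = C ** B}"
proof -
  have *: "B ** C = C ** B"
    if "A ** B = B ** A" "A ** C = C ** A" "\<And>c. A \<noteq> mat c" for A B C :: "'a ^ 2 ^ 2"
  proof -
    obtain t x y z where A: "A = qmat t x y z" by (rule qmat_exhaust)
    obtain t' x' y' z' where B: "B = qmat t' x' y' z'" by (rule qmat_exhaust)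
    obtain t'' x'' y'' z'' where C: "C = qmat t'' x'' y'' z''" by (rule qmat_exhaust)
    have "x \<noteq> 0 \<or> y \<noteq> 0 \<or> z \<noteq> 0" using that(3) by (simp add: A mat_eq_qmat qmat_eq_iff)
    then show ?thesis
      using that(1,2) parallel_trans[of x y' x' y z' z y'' x'' z'']
      by (simp add: A B C qmat_commute_iff)
  qed
  show ?thesis using *[OF AB _ A] *[OF AB[symmetric] _ B] by auto
qed

end

section \<open>The projective linear group\<close>

lemma mat_mult_nth: "(mat c ** A) $ i $ j = c * (A :: 'a::field ^ 'n ^ 'm) $ i $ j"
proof -
  have "(mat c ** A) $ i $ j = (\<Sum>k\<in>UNIV. if i = k then c * A $ k $ j else 0)"
    unfolding matrix_matrix_mult_def mat_def vec_lambda_beta by (rule sum.cong) auto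
  then show ?thesis by simp
qed

lemma mult_mat_nth: "(A ** mat c) $ i $ j = c * (A :: 'a::field ^ 'n ^ 'm) $ i $ j"
proof -
  have "(A ** mat c) $ i $ j = (\<Sum>k\<in>UNIV. if k = j then c * A $ i $ k else 0)"
    unfolding matrix_matrix_mult_def mat_def vec_lambda_beta by (rule sum.cong) auto
  then show ?thesis by simp
qed

lemma mat_mult_commute: "mat c ** A = A ** mat c" for A :: "'a::field ^ 'n ^ 'm"
  by (simp add: vec_eq_iff mat_mult_nth mult_mat_nth)

lemma mat_mult_mat: "mat c ** mat d = (mat (c * d) :: 'a::field ^ 'n ^ 'n)"
  by (simp add: vec_eq_iff mat_mult_nth) (simp add: mat_def)

lemma invertible_mat: "c \<noteq> 0 \<Longrightarrow> invertible (mat c :: 'a::field ^ 'n ^ 'n)"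
  unfolding invertible_def by (rule exI[of _ "mat (1 / c)"]) (simp add: mat_mult_mat)

lemma group_GL: "group (GL :: ('a::field ^ 'n ^ 'n) monoid)"
proof (rule groupI)
  fix A :: "'a ^ 'n ^ 'n" assume "A \<in> carrier GL"
  then obtain B where B: "A ** B = mat 1" "B ** A = mat 1"
    by (auto simp: GL_def invertible_def)
  then show "\<exists>B\<in>carrier GL. B \<otimes>\<^bsub>GL\<^esub> A = \<one>\<^bsub>GL\<^esub>"
    by (auto simp: GL_def invertible_def)
qed (auto simp: GL_def invertible_mult matrix_mul_assoc invertible_mat)

lemma normal_scalar_matrices: "scalar_matrices \<lhd> (GL :: ('a::field ^ 'n ^ 'n) monoid)"
proof -
  interpret group "GL :: ('a ^ 'n ^ 'n) monoid" by (rule group_GL)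
  have sub: "subgroup scalar_matrices (GL :: ('a ^ 'n ^ 'n) monoid)"
  proof (rule subgroupI)
    show "scalar_matrices \<subseteq> carrier (GL :: ('a ^ 'n ^ 'n) monoid)"
      by (auto simp: scalar_matrices_def GL_def invertible_mat)
    show "(scalar_matrices :: ('a ^ 'n ^ 'n) set) \<noteq> {}"
      by (auto simp: scalar_matrices_def intro!: exI[of _ "1 :: 'a"])
  next
    fix A :: "'a ^ 'n ^ 'n" assume "A \<in> scalar_matrices"
    then obtain c where c: "A = mat c" "c \<noteq> 0" by (auto simp: scalar_matrices_def)
    then have "inv\<^bsub>GL\<^esub> A = mat (1 / c)"
      by (intro inv_equality) (auto simp: GL_def mat_mult_mat invertible_mat)
    then show "inv\<^bsub>GL\<^esub> A \<in> scalar_matrices" using c by (auto simp: scalar_matrices_def)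
  next
    fix A B :: "'a ^ 'n ^ 'n" assume "A \<in> scalar_matrices" "B \<in> scalar_matrices"
    then obtain c d where "A = mat c" "B = mat d" "c * d \<noteq> 0" by (auto simp: scalar_matrices_def)
    then show "A \<otimes>\<^bsub>GL\<^esub> B \<in> scalar_matrices"
      by (auto simp: scalar_matrices_def GL_def mat_mult_mat)
  qed
  show ?thesis
    \<comment> \<open>Scalar matrices are central, so left and right cosets agree.\<close>
    by (rule normalI[OF sub]) (auto simp: r_coset_def l_coset_def scalar_matrices_def GL_def mat_mult_commute)
qed

lemma group_PGL: "group (PGL :: ('a::field ^ 'n ^ 'n) set monoid)"
  unfolding PGL_def by (rule normal.factorgroup_is_group[OF normal_scalar_matrices])

abbreviation proj :: "'a::field ^ 'n ^ 'n \<Rightarrow> ('a ^ 'n ^ 'n) set" where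
  "proj A \<equiv> scalar_matrices #>\<^bsub>GL\<^esub> A"

lemma proj_eq: "proj A = {mat c ** A | c. c \<noteq> 0}"
  by (auto simp: r_coset_def scalar_matrices_def GL_def)

lemma self_in_proj: "A \<in> proj A"
  by (auto simp: proj_eq intro!: exI[of _ 1])

lemma group_hom_proj: "group_hom GL PGL (proj :: 'a::field ^ 'n ^ 'n \<Rightarrow> _)"
  using normal.r_coset_hom_Mod[OF normal_scalar_matrices] group_GL group_PGL
  by (intro group_hom.intro group_hom_axioms.intro) (simp_all add: PGL_def)

lemma carrier_PGL: "carrier PGL = proj ` {A. invertible A}"
  by (simp add: PGL_def carrier_FactGroup) (simp add: GL_def)

lemma proj_mult:
  "invertible A \<Longrightarrow> invertible B \<Longrightarrow> proj A \<otimes>\<^bsub>PGL\<^esub> proj B = proj (A ** B)"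
  using group_hom.hom_mult[OF group_hom_proj, of A B] by (simp add: GL_def)

lemma proj_eq_iff: "proj A = proj B \<longleftrightarrow> (\<exists>c. c \<noteq> 0 \<and> B = mat c ** A)"
proof
  assume "proj A = proj B"
  with self_in_proj[of B] show "\<exists>c. c \<noteq> 0 \<and> B = mat c ** A" by (auto simp: proj_eq)
next
  assume "\<exists>c. c \<noteq> 0 \<and> B = mat c ** A"
  then obtain c where c: "c \<noteq> 0" "B = mat c ** A" by blast
  have "\<exists>d'. d' \<noteq> 0 \<and> mat d ** A = mat d' ** B" if "d \<noteq> 0" for d
    using that c by (intro exI[of _ "d / c"]) (simp add: matrix_mul_assoc mat_mult_mat)
  moreover have "\<exists>d'. d' \<noteq> 0 \<and> mat d ** B = mat d' ** A" if "d \<noteq> 0" for d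
    using that c by (intro exI[of _ "d * c"]) (simp add: matrix_mul_assoc mat_mult_mat)
  ultimately show "proj A = proj B" unfolding proj_eq by fast
qed

lemma proj_eq_one_iff:
  fixes A :: "'a::field ^ 'n ^ 'n"
  shows "proj A = \<one>\<^bsub>PGL\<^esub> \<longleftrightarrow> (\<exists>c. c \<noteq> 0 \<and> A = mat c)"
proof -
  have "\<one>\<^bsub>PGL\<^esub> = proj (mat 1 :: 'a ^ 'n ^ 'n)"
    by (simp add: PGL_def proj_eq) (simp add: scalar_matrices_def)
  then show ?thesis using proj_eq_iff[of "mat 1" A] by (auto simp: eq_commute)
qed

text \<open>Commuting is meant exactly and not up to scalars, so this is a centralizer in the full
  matrix ring and not in \<open>PGL\<close>. Quantifying over all representatives makes it a
  function of the coset; it serves as the invariant \<open>\<tau>\<close>.\<close>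

definition coset_centralizer :: "('a::field ^ 'n ^ 'n) set \<Rightarrow> ('a ^ 'n ^ 'n) set" where
  "coset_centralizer X = {B. \<forall>A\<in>X. A ** B = B ** A}"

text \<open>A nonzero scalar factor does not affect commuting, so one representative
  suffices.\<close>

lemma coset_centralizer_proj:
  fixes A :: "'a::field ^ 'n ^ 'n"
  shows "coset_centralizer (proj A) = {B. A ** B = B ** A}"
proof -
  have *: "mat c ** A ** B = B ** (mat c ** A) \<longleftrightarrow> A ** B = B ** A" if "c \<noteq> 0" for c B
  proof -
    have "mat c ** A ** B = mat c ** (A ** B)" by (simp add: matrix_mul_assoc)
    moreover have "B ** (mat c ** A) = mat c ** (B ** A)"
      by (simp add: matrix_mul_assoc mat_mult_commute[of c B])
    ultimately show ?thesis using that by (simp add: vec_eq_iff mat_mult_nth)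
  qed
  show ?thesis
  proof (intro equalityI subsetI)
    fix B assume "B \<in> coset_centralizer (proj A)"
    then show "B \<in> {B. A ** B = B ** A}"
      using self_in_proj[of A] by (simp add: coset_centralizer_def)
  next
    fix B assume "B \<in> {B. A ** B = B ** A}"
    then show "B \<in> coset_centralizer (proj A)"
      using * by (auto simp: coset_centralizer_def proj_eq)
  qed
qed

text \<open>For nonzero \<open>y\<close> the equation determines \<open>z\<close> from
  \<open>x\<close> and \<open>y\<close>, while \<open>y = 0\<close> forces \<open>x = 0\<close> and
  leaves \<open>z\<close> free. With q the field size, these are (q - 1) q + q points, enumerated by
  \<open>?g\<close>.\<close>

lemma card_isotropic:
  "card ({(x, y, z). x\<^sup>2 + y * z = 0} :: ('a::{field,finite} \<times> 'a \<times> 'a) set) = CARD('a) ^ 2"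
proof -
  let ?Z = "{(x, y, z). x\<^sup>2 + y * z = 0} :: ('a \<times> 'a \<times> 'a) set"
  let ?g = "\<lambda>(a :: 'a, b :: 'a). if b = 0 then (0, 0, a) else (a, b, - a\<^sup>2 / b)"
  have "bij_betw ?g (UNIV \<times> UNIV) ?Z"
  proof (rule bij_betw_imageI)
    show "inj_on ?g (UNIV \<times> UNIV)" by (auto simp: inj_on_def split: if_splits)
    have "(x, y, z) \<in> range ?g" if "x\<^sup>2 + y * z = 0" for x y z :: 'a
    proof (cases "y = 0")
      case True
      then have "(x, y, z) = ?g (z, 0)" using that by simp
      then show ?thesis by blast
    next
      case False
      then have "z = - x\<^sup>2 / y" using that by (simp add: field_simps eq_neg_iff_add_eq_0)
      then have "(x, y, z) = ?g (x, y)" using False by simp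
      then show ?thesis by blast
    qed
    then show "?g ` (UNIV \<times> UNIV) = ?Z" by (auto split: if_splits)
  qed
  then show ?thesis using bij_betw_same_card by (fastforce simp: card_cartesian_product power2_eq_square)
qed

lemma (in group) int_pow_commute: "x \<in> carrier G \<Longrightarrow> x \<otimes> x [^] (k::int) = x [^] k \<otimes> x"
  using int_pow_mult[of x 1 k] int_pow_mult[of x k 1] by (simp add: add.commute)

text \<open>The power of \<open>A\<close> in \<open>GL\<close> serves as \<open>B\<close>. This
  prepares the use of \<open>centralizer_eq\<close> for a class and its powers.\<close>

lemma proj_int_pow:
  fixes A :: "'a::field ^ 'n ^ 'n" and k :: int
  assumes "invertible A"
  obtains B where "invertible B" "A ** B = B ** A" "proj A [^]\<^bsub>PGL\<^esub> k = proj B"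
proof
  interpret group "GL :: ('a ^ 'n ^ 'n) monoid" by (rule group_GL)
  let ?B = "A [^]\<^bsub>GL\<^esub> k"
  have A: "A \<in> carrier GL" using assms by (simp add: GL_def)
  have "?B \<in> carrier GL" using A by simp
  then show "invertible ?B" by (simp add: GL_def)
  show "A ** ?B = ?B ** A" using int_pow_commute[OF A, of k] by (simp add: GL_def)
  show "proj A [^]\<^bsub>PGL\<^esub> k = proj ?B" using group_hom.hom_int_pow[OF group_hom_proj A] by simp
qed

text \<open>The traceless part M satisfies M^2 = 0, so (1 + k M)(1 + M) = 1 + (k + 1) M.\<close>

lemma qmat_unipotent_pow:
  assumes "x\<^sup>2 + y * z = 0"
  shows "qmat 1 x y z [^]\<^bsub>GL\<^esub> (k::nat) = qmat 1 (of_nat k * x) (of_nat k * y) (of_nat k * z)"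
proof (induction k)
  case 0
  then show ?case by (simp add: GL_def mat_eq_qmat)
next
  case (Suc k)
  have "qmat 1 (of_nat k * x) (of_nat k * y) (of_nat k * z) ** qmat 1 x y z
      = qmat 1 (of_nat (Suc k) * x) (of_nat (Suc k) * y) (of_nat (Suc k) * z)"
    using assms by (simp add: matrix_2_eq_iff matrix_matrix_mult_def sum_2) Groebner_Basis.algebra
  then show ?case using Suc by (simp add: GL_def)
qed

section \<open>Components for PGL(2,q)\<close>

theorem theorem3p5:
  fixes p n :: nat
    and G :: "('a::{field,finite} ^ 2 ^ 2) set monoid"
  assumes "prime p" and "odd p" and "n > 0"
    and "CARD('a) = p ^ n" and "G = PGL"
  shows "real (card (connected_components (with_proj (proper_power_graph G)))) =
           (real p ^ (2 * n + 1) - 1) / (real p - 1)"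
proof -
  let ?PGL = "PGL :: ('a ^ 2 ^ 2) set monoid"
  let ?q = "CARD('a)"
  let ?Z = "{(x, y, z). x\<^sup>2 + y * z = 0} :: ('a \<times> 'a \<times> 'a) set"
  let ?D = "carrier ?PGL - {\<one>\<^bsub>?PGL\<^esub>}"
  let ?u = "\<lambda>(x, y, z). proj (qmat 1 x y z) :: ('a ^ 2 ^ 2) set"
  let ?N = "?u ` (?Z - {(0, 0, 0)})"
  let ?I = "{b \<in> ?D. b \<otimes>\<^bsub>?PGL\<^esub> b = \<one>\<^bsub>?PGL\<^esub>}"
  interpret group ?PGL by (rule group_PGL)

  \<comment> \<open>The characteristic of the field\<close>
  have "CHAR('a) dvd p ^ n" using CHAR_dvd_CARD[where 'a = 'a] assms(4) by simp
  moreover have "prime CHAR('a)" by (intro prime_CHAR_semidom finite_imp_CHAR_pos) simp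
  ultimately have char: "CHAR('a) = p"
    using prime_dvd_power primes_dvd_imp_eq assms(1) by blast
  have p0: "(of_nat p :: 'a) = 0" using char of_nat_CHAR by metis
  have two: "(2 :: 'a) \<noteq> 0"
  proof
    assume "(2 :: 'a) = 0"
    then have "(of_nat 2 :: 'a) = 0" by simp
    then have "p dvd 2" using char of_nat_eq_0_iff_char_dvd by metis
    then show False using assms(1,2) by (metis dvd_refl primes_dvd_imp_eq two_is_prime_nat)
  qed

  \<comment> \<open>Classes and their centralizers in coordinates\<close>
  have elem: "\<exists>t x y z. X = proj (qmat t x y z) \<and> t\<^sup>2 \<noteq> x\<^sup>2 + y * z \<and> (x \<noteq> 0 \<or> y \<noteq> 0 \<or> z \<noteq> 0)"
    if X: "X \<in> ?D" for X
  proof -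
    obtain A where A: "X = proj A" "invertible A" using X by (auto simp: carrier_PGL)
    obtain t x y z where A': "A = qmat t x y z" by (rule qmat_exhaust[OF two])
    have t: "t\<^sup>2 \<noteq> x\<^sup>2 + y * z" using A(2) by (simp add: A' invertible_qmat_iff)
    have "x \<noteq> 0 \<or> y \<noteq> 0 \<or> z \<noteq> 0"
    proof (rule ccontr)
      assume "\<not> (x \<noteq> 0 \<or> y \<noteq> 0 \<or> z \<noteq> 0)"
      then have "A = mat t" "t \<noteq> 0" using t by (auto simp: A' mat_eq_qmat)
      then have "X = \<one>\<^bsub>?PGL\<^esub>" using A by (auto simp: proj_eq_one_iff)
      then show False using X by simp
    qed
    then show ?thesis using A A' t by blast
  qed
  have in_D: "proj (qmat t x y z) \<in> ?D"
    if "t\<^sup>2 \<noteq> x\<^sup>2 + y * z" "x \<noteq> 0 \<or> y \<noteq> 0 \<or> z \<noteq> 0" for t x y z :: 'a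
    using that by (auto simp: carrier_PGL proj_eq_one_iff invertible_qmat_iff mat_eq_qmat_iff[OF two])
  have centr_iff: "coset_centralizer (proj (qmat t x y z)) = coset_centralizer (proj (qmat t' x' y' z'))
      \<Longrightarrow> x * y' = x' * y \<and> y * z' = y' * z \<and> x * z' = x' * z" for t x y z t' x' y' z' :: 'a
  proof -
    assume "coset_centralizer (proj (qmat t x y z)) = coset_centralizer (proj (qmat t' x' y' z'))"
    \<comment> \<open>A matrix commutes with itself, so it lies in its own centralizer and by
      assumption in the other one.\<close>
    then have "qmat t' x' y' z' \<in> coset_centralizer (proj (qmat t x y z))"
      by (simp add: coset_centralizer_proj)
    then show ?thesis by (simp add: coset_centralizer_proj qmat_commute_iff[OF two])
  qed
  have unip: "proj (qmat t x y z) \<in> ?N"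
    if "t \<noteq> 0" "x\<^sup>2 + y * z = 0" "x \<noteq> 0 \<or> y \<noteq> 0 \<or> z \<noteq> 0" for t x y z :: 'a
  proof -
    \<comment> \<open>Dividing by \<open>t\<close> normalises the scalar part to 1.\<close>
    have "proj (qmat t x y z) = proj (qmat 1 (x / t) (y / t) (z / t))"
      unfolding proj_eq_iff using that
      by (intro exI[of _ "1 / t"]) (simp add: mat_mult_qmat)
    moreover have "(x / t, y / t, z / t) \<in> ?Z - {(0, 0, 0)}"
    proof -
      have "(x / t)\<^sup>2 + y / t * (z / t) = (x\<^sup>2 + y * z) / t\<^sup>2"
        by (simp add: add_divide_distrib power2_eq_square)
      then show ?thesis using that by simp
    qed
    ultimately show ?thesis by (force intro: rev_image_eqI)
  qed
  \<comment> \<open>With B the traceless part and d its square, (t + B)^2 = (t^2 + d) + 2 t B is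
    scalar only if t B = 0, and B is nonzero.\<close>
  have square: "t = 0" if "proj (qmat t x y z) \<otimes>\<^bsub>?PGL\<^esub> proj (qmat t x y z) = \<one>\<^bsub>?PGL\<^esub>"
      "t\<^sup>2 \<noteq> x\<^sup>2 + y * z" "x \<noteq> 0 \<or> y \<noteq> 0 \<or> z \<noteq> 0" for t x y z :: 'a
    using that two
    by (auto simp: proj_mult invertible_qmat_iff proj_eq_one_iff qmat_mult_self mat_eq_qmat_iff)
  have square0: "proj (qmat 0 x y z) \<otimes>\<^bsub>?PGL\<^esub> proj (qmat 0 x y z) = \<one>\<^bsub>?PGL\<^esub>"
    if "x\<^sup>2 + y * z \<noteq> 0" for x y z :: 'a
    using that
    by (simp add: proj_mult invertible_qmat_iff proj_eq_one_iff qmat_mult_self mat_eq_qmat_iff[OF two])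

  \<comment> \<open>The hypotheses of the component count\<close>
  have main: "(p - 1) * card (connected_components (with_proj (proper_power_graph ?PGL)))
    = card ?N + (p - 1) * card ?I"
  proof (rule card_components_proper_power_graph[where \<tau> = coset_centralizer])
    show "finite (carrier ?PGL)" "prime p" "odd p" using assms by simp_all
  next
    fix X and k :: int
    assume X: "X \<in> carrier ?PGL" and ne: "X [^]\<^bsub>?PGL\<^esub> k \<noteq> \<one>\<^bsub>?PGL\<^esub>"
    obtain A where A: "X = proj A" "invertible A" using X by (auto simp: carrier_PGL)
    obtain B where B: "invertible B" "A ** B = B ** A" "X [^]\<^bsub>?PGL\<^esub> k = proj B"
      using proj_int_pow[OF A(2)] A(1) by blast
    have nz: "c \<noteq> 0" if "invertible (mat c :: 'a ^ 2 ^ 2)" for c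
      using that invertible_qmat_iff[of c 0 0 0] by (auto simp: mat_eq_qmat)
    have "B \<noteq> mat c" for c
      using ne B nz by (auto simp: proj_eq_one_iff)
    moreover have "A \<noteq> mat c" for c
    proof
      assume "A = mat c"
      then have "X = \<one>\<^bsub>?PGL\<^esub>" using A nz by (auto simp: proj_eq_one_iff)
      then show False using ne by simp
    qed
    \<comment> \<open>\<open>B\<close> commutes with \<open>A\<close> and neither is scalar, so
      their centralizers agree.\<close>
    ultimately show "coset_centralizer (X [^]\<^bsub>?PGL\<^esub> k) = coset_centralizer X"
      using centralizer_eq[OF two B(2)] unfolding B(3) unfolding A(1) coset_centralizer_proj by simp
  next
    show "?N \<subseteq> ?D"
    proof
      fix X assume "X \<in> ?N"
      then obtain x y z :: 'a where "X = proj (qmat 1 x y z)" "x\<^sup>2 + y * z = 0"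
        "x \<noteq> 0 \<or> y \<noteq> 0 \<or> z \<noteq> 0" by auto
      then show "X \<in> ?D" using in_D[of 1 x y z] by simp
    qed
  next
    fix X assume "X \<in> ?N"
    then obtain x y z :: 'a where X: "X = proj (qmat 1 x y z)" "x\<^sup>2 + y * z = 0" by auto
    have "qmat 1 x y z \<in> carrier GL" using X(2) by (simp add: GL_def invertible_qmat_iff)
    then have "X [^]\<^bsub>?PGL\<^esub> p = proj (qmat 1 x y z [^]\<^bsub>GL\<^esub> p)"
      using group_hom.hom_nat_pow[OF group_hom_proj] X(1) by metis
    also have "\<dots> = \<one>\<^bsub>?PGL\<^esub>"
      using X(2) p0 by (auto simp: qmat_unipotent_pow proj_eq_one_iff mat_eq_qmat intro!: exI[of _ 1])
    finally show "X [^]\<^bsub>?PGL\<^esub> p = \<one>\<^bsub>?PGL\<^esub>" .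
  next
    fix X Y assume "X \<in> ?N" and Y: "Y \<in> ?D" and eq: "coset_centralizer Y = coset_centralizer X"
    then obtain x y z :: 'a where X: "X = proj (qmat 1 x y z)" "x\<^sup>2 + y * z = 0" "x \<noteq> 0 \<or> y \<noteq> 0 \<or> z \<noteq> 0"
      by auto
    obtain t x' y' z' where Y': "Y = proj (qmat t x' y' z')" "t\<^sup>2 \<noteq> x'\<^sup>2 + y' * z'"
      "x' \<noteq> 0 \<or> y' \<noteq> 0 \<or> z' \<noteq> 0" using elem[OF Y] by blast
    \<comment> \<open>Equal centralizers make the traceless part of \<open>Y\<close> a multiple of
      that of \<open>X\<close>, hence of square zero; invertibility then forces
      \<open>t \<noteq> 0\<close>.\<close>
    obtain c where c: "x' = c * x" "y' = c * y" "z' = c * z"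
      using centr_iff[of 1 x y z t x' y' z'] eq X Y' parallelE[OF two, of x y' x' y z' z] by metis
    have "x'\<^sup>2 + y' * z' = c\<^sup>2 * (x\<^sup>2 + y * z)" unfolding c by (simp add: algebra_simps power2_eq_square)
    then have "x'\<^sup>2 + y' * z' = 0" using X(2) by simp
    moreover from this have "t \<noteq> 0" using Y'(2) by auto
    ultimately show "Y \<in> ?N" unfolding Y'(1) using Y'(3) by (intro unip)
  next
    fix X assume X: "X \<in> ?D - ?N"
    obtain t x y z where X': "X = proj (qmat t x y z)" "t\<^sup>2 \<noteq> x\<^sup>2 + y * z"
      "x \<noteq> 0 \<or> y \<noteq> 0 \<or> z \<noteq> 0" using elem[of X] X by blast
    have d: "x\<^sup>2 + y * z \<noteq> 0"
    proof
      assume d: "x\<^sup>2 + y * z = 0"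
      then have "t \<noteq> 0" using X'(2) by auto
      then have "X \<in> ?N" unfolding X'(1) using d X'(3) by (rule unip)
      then show False using X by simp
    qed
    \<comment> \<open>Dropping the scalar part leaves a matrix that commutes with the original one.
      It is invertible, since its determinant is minus the nonzero value
      \<open>x\<^sup>2 + y * z\<close>.\<close>
    let ?b = "proj (qmat 0 x y z)"
    have comm: "qmat t x y z ** qmat 0 x y z = qmat 0 x y z ** qmat t x y z"
      by (simp add: qmat_commute_iff[OF two])
    have ns: "qmat s x y z \<noteq> mat c" for s c using X'(3) by (auto simp: mat_eq_qmat_iff[OF two])
    show "\<exists>b\<in>?D. b \<otimes>\<^bsub>?PGL\<^esub> b = \<one>\<^bsub>?PGL\<^esub> \<and> coset_centralizer b = coset_centralizer X
        \<and> X \<otimes>\<^bsub>?PGL\<^esub> b = b \<otimes>\<^bsub>?PGL\<^esub> X"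
    proof (intro bexI conjI)
      show "?b \<in> ?D" using in_D[of 0 x y z] X'(3) d by simp
      show "?b \<otimes>\<^bsub>?PGL\<^esub> ?b = \<one>\<^bsub>?PGL\<^esub>" by (rule square0[OF d])
      show "coset_centralizer ?b = coset_centralizer X"
        using centralizer_eq[OF two comm ns ns] by (simp add: X' coset_centralizer_proj)
      show "X \<otimes>\<^bsub>?PGL\<^esub> ?b = ?b \<otimes>\<^bsub>?PGL\<^esub> X"
        using X' d comm by (simp add: proj_mult invertible_qmat_iff)
    qed
  next
    fix b b' assume b: "b \<in> ?D" "b' \<in> ?D" "b \<otimes>\<^bsub>?PGL\<^esub> b = \<one>\<^bsub>?PGL\<^esub>" "b' \<otimes>\<^bsub>?PGL\<^esub> b' = \<one>\<^bsub>?PGL\<^esub>"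
      and eq: "coset_centralizer b = coset_centralizer b'"
    obtain t x y z where X: "b = proj (qmat t x y z)" "t\<^sup>2 \<noteq> x\<^sup>2 + y * z"
      "x \<noteq> 0 \<or> y \<noteq> 0 \<or> z \<noteq> 0" using elem[OF b(1)] by blast
    obtain t' x' y' z' where X': "b' = proj (qmat t' x' y' z')" "t'\<^sup>2 \<noteq> x'\<^sup>2 + y' * z'"
      "x' \<noteq> 0 \<or> y' \<noteq> 0 \<or> z' \<noteq> 0" using elem[OF b(2)] by blast
    have t: "t = 0" "t' = 0" using square X X' b by blast+
    \<comment> \<open>Both representatives are now traceless, so parallel coordinates make them
      multiples of each other and their classes equal.\<close>
    obtain c where c: "x' = c * x" "y' = c * y" "z' = c * z"
      using centr_iff[of t x y z t' x' y' z'] eq X X' parallelE[OF two, of x y' x' y z' z] by metis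
    have "c \<noteq> 0" using c X'(3) by auto
    then show "b = b'"
      unfolding X X' proj_eq_iff t c by (intro exI[of _ c]) (simp add: mat_mult_qmat)
  qed

  \<comment> \<open>Numbers of unipotent elements and of involutions\<close>
  have card_N: "card ?N = ?q ^ 2 - 1"
  proof -
    \<comment> \<open>Both representatives have scalar part 1, so a factor relating them is
      1.\<close>
    have "inj_on ?u (?Z - {(0, 0, 0)})"
      by (auto simp: inj_on_def proj_eq_iff mat_mult_qmat qmat_eq_iff[OF two])
    then have "card ?N = card (?Z - {(0, 0, 0)})" by (rule card_image)
    then show ?thesis using card_isotropic[where 'a = 'a] by (simp add: card_Diff_subset)
  qed
  have card_I: "(?q - 1) * card ?I = ?q ^ 3 - ?q ^ 2"
  proof -
    let ?m = "\<lambda>(x, y, z). qmat 0 x y z :: 'a ^ 2 ^ 2"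
    let ?M = "?m ` (- ?Z)"
    have I: "?I = proj ` ?M"
    proof (intro equalityI subsetI)
      fix b assume b: "b \<in> ?I"
      then obtain t x y z where X: "b = proj (qmat t x y z)" "t\<^sup>2 \<noteq> x\<^sup>2 + y * z"
        "x \<noteq> 0 \<or> y \<noteq> 0 \<or> z \<noteq> 0" using elem[of b] by blast
      then have t: "t = 0" using square[of t x y z] b by blast
      then have "(x, y, z) \<in> - ?Z" using X(2) by auto
      then have "?m (x, y, z) \<in> ?M" by (rule imageI)
      then show "b \<in> proj ` ?M" using X(1) t by simp
    next
      fix b assume "b \<in> proj ` ?M"
      then obtain x y z :: 'a where b: "b = proj (qmat 0 x y z)" "x\<^sup>2 + y * z \<noteq> 0" by auto
      then have "x \<noteq> 0 \<or> y \<noteq> 0 \<or> z \<noteq> 0" by auto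
      then show "b \<in> ?I" using in_D[of 0 x y z] square0[of x y z] b by simp
    qed
    \<comment> \<open>Each involution is a coset of \<open>?q - 1\<close> matrices, and distinct
      cosets are disjoint. Their union is the set of invertible traceless matrices, counted through
      the complement of \<open>?Z\<close>.\<close>
    have "(?q - 1) * card ?I = card (\<Union>?I)"
    proof (rule card_partition)
      show "finite ?I" "finite (\<Union>?I)" by simp_all
    next
      fix b assume "b \<in> ?I"
      then obtain x y z :: 'a where b: "b = proj (qmat 0 x y z)" "x\<^sup>2 + y * z \<noteq> 0" unfolding I by auto
      have "b = (\<lambda>c. mat c ** qmat 0 x y z) ` (UNIV - {0})" unfolding b proj_eq by auto
      moreover have "inj_on (\<lambda>c. mat c ** qmat 0 x y z) (UNIV - {0})"
        using b(2) by (auto simp: inj_on_def mat_mult_qmat qmat_eq_iff[OF two])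
      ultimately show "card b = ?q - 1" by (simp add: card_image card_Diff_subset)
    next
      fix b b' assume b: "b \<in> ?I" "b' \<in> ?I" "b \<noteq> b'"
      then have "b \<in> rcosets\<^bsub>GL\<^esub> scalar_matrices" "b' \<in> rcosets\<^bsub>GL\<^esub> scalar_matrices"
        by (auto simp: PGL_def FactGroup_def)
      then show "b \<inter> b' = {}"
        using group.rcos_disjoint[OF group_GL normal_imp_subgroup[OF normal_scalar_matrices]] b(3)
        by (auto simp: pairwise_def disjnt_def)
    qed
    also have "\<Union>?I = ?M"
    proof (intro equalityI subsetI)
      fix A assume "A \<in> \<Union>?I"
      then obtain x y z c :: 'a where A: "A = mat c ** qmat 0 x y z" "c \<noteq> 0" "x\<^sup>2 + y * z \<noteq> 0"
        unfolding I by (auto simp: proj_eq)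
      \<comment> \<open>Scaling by \<open>c\<close> multiplies the quadratic form by
        \<open>c\<^sup>2\<close>, so invertible traceless matrices are stable under nonzero
        scalars.\<close>
      have "(c * x)\<^sup>2 + (c * y) * (c * z) = c\<^sup>2 * (x\<^sup>2 + y * z)"
        by (simp add: algebra_simps power2_eq_square)
      then have "(c * x, c * y, c * z) \<in> - ?Z" using A by simp
      then have "?m (c * x, c * y, c * z) \<in> ?M" by (rule imageI)
      then show "A \<in> ?M" using A(1) by (simp add: mat_mult_qmat)
    next
      fix A assume "A \<in> ?M"
      then show "A \<in> \<Union>?I" unfolding I using self_in_proj by blast
    qed
    also have "card ?M = card (- ?Z)"
      by (rule card_image) (auto simp: inj_on_def qmat_eq_iff[OF two])
    also have "\<dots> = ?q ^ 3 - ?q ^ 2"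
      using card_isotropic[where 'a = 'a]
      by (simp add: Compl_eq_Diff_UNIV card_Diff_subset power3_eq_cube)
    finally show ?thesis .
  qed

  \<comment> \<open>Passage to the real quotient\<close>
  have q: "?q > 1" using assms(3,4) one_less_power[OF prime_gt_1_nat[OF assms(1)]] by simp
  \<comment> \<open>This bound turns the truncated subtraction in \<open>?q ^ 2 - 1\<close> into the
    real one.\<close>
  then have q2: "?q ^ 2 \<ge> 1" by simp
  have "?q ^ 3 - ?q ^ 2 = (?q - 1) * ?q ^ 2" by (simp add: diff_mult_distrib power3_eq_cube power2_eq_square)
  then have card_I': "card ?I = ?q ^ 2" using card_I q by simp
  have "real p - 1 > 0" using assms(1) prime_gt_1_nat[of p] by simp
  moreover have "(real p - 1) * real (card (connected_components (with_proj (proper_power_graph ?PGL))))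
      = real p ^ (2 * n + 1) - 1"
  proof -
    have "real ((p - 1) * card (connected_components (with_proj (proper_power_graph ?PGL))))
      = real (?q ^ 2 - 1 + (p - 1) * ?q ^ 2)" unfolding main card_N card_I' ..
    moreover have "real ?q ^ 2 = real p ^ (2 * n)" by (simp add: assms(4) power_mult mult.commute[of 2])
    ultimately show ?thesis
      using q2 prime_gt_1_nat[OF assms(1)] by (simp add: of_nat_diff algebra_simps)
  qed
  ultimately show ?thesis by (simp add: assms(5) field_simps)
qed

end
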